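(* Let $\mathbb{K}$ be a field of characteristic $0$, let $p$ be a non-zero polynomial with coefficients in $\mathbb{K}$ and with root $0$, let $q\in\mathbb{K}$ be a non-zero element that is not a root of unity, and let $r\in\mathbb{K}$. Then, for any root $\zeta\in\mathbb{K}$ of $p$, the $\mathbb{K}$-linear map $\tau_\zeta:\mathcal{B}(p;q,r)\to\mathbb{K}$ defined on the basis of monomials $x^mz^n$, $y^mz^n$ ($m,n\in\mathbb{N}$) by $$\tau_\zeta(x^mz^n)=\tau_\zeta(y^mz^n)=\begin{cases}\hat\tau_\zeta(z^n),& m=0,\ n\neq0,\\ 0,&\text{otherwise},\end{cases}$$ is a trace (cyclic cocycle) on $\mathcal{B}(p;q,r)$, i.e. $\tau_\zeta(ab)=\tau_\zeta(ba)$ for all $a,b\in\mathcal{B}(p;q,r)$.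
   Context: $\mathcal{B}(p;q,r)$ is the associative unital $\mathbb{K}$-algebra generated by $x,y,z$ subject to the relations $$xy=p(qz+r),\quad yx=p(z),\quad xz=(qz+r)x,\quad yz=q^{-1}(z-r)y.$$ A basis for it is given by the monomials $x^kz^l$ and $y^kz^l$, $k,l\in\mathbb{N}$ (with $0\in\mathbb{N}$; the elements with $k=0$ coincide in the two families). The $\mathbb{K}$-linear map $\hat\tau_\zeta:\mathbb{K}[z]\to\mathbb{K}$ is defined by $\hat\tau_\zeta(1)=0$ and, for $n\geq1$, $$\hat\tau_\zeta(z^n)=\frac{1}{1-q^n}\sum_{i=1}^n t^n_i\zeta^i,$$ where the coefficients $t^n_i\in\mathbb{K}$ are given recursively by $$t^n_n=1,\qquad t^n_{n-k}=\sum_{i=1}^k\binom{n}{i}\frac{r^iq^{n-i}}{1-q^{n-i}}\,t^{n-i}_{n-k},\quad k=1,\dots,n-1.$$ *)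

theory Defs
  imports "HOL-Library.Poly_Mapping" "HOL-Library.FuncSet"
    "HOL-Computational_Algebra.Polynomial" "HOL-Algebra.Algebraic_Closure_Type"
begin

section \<open>The free algebra on three generators\<close>

text \<open>
  Words form a (non-commutative) monoid under concatenation, written additively because the
  convolution product of \<open>\<Rightarrow>\<^sub>0\<close> expects a \<^class>\<open>monoid_add\<close> of exponents.  Thus
  \<open>word \<Rightarrow>\<^sub>0 'k\<close> is the monoid algebra of the free monoid, i.e. the free associative unital
  algebra \<open>'k\<langle>x,y,z\<rangle>\<close>.
\<close>

datatype gen = GenX | GenY | GenZ

datatype word = Word (letters: "gen list")

instantiation word :: monoid_add
begin

definition zero_word :: word where "zero_word = Word []"

definition plus_word :: "word \<Rightarrow> word \<Rightarrow> word" where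
  "plus_word u v = Word (letters u @ letters v)"

instance
  by standard (simp_all add: zero_word_def plus_word_def)

end

type_synonym 'k free_alg = "word \<Rightarrow>\<^sub>0 'k"

definition gen :: "gen \<Rightarrow> 'k::field free_alg" where
  "gen g = Poly_Mapping.single (Word [g]) 1"

definition scal :: "'k::field \<Rightarrow> 'k free_alg" where
  "scal c = Poly_Mapping.single 0 c"

text \<open>Evaluation at \<open>a\<close>; the library's \<^const>\<open>poly\<close> needs a commutative target.\<close>

definition eval_at :: "'k::field poly \<Rightarrow> 'k free_alg \<Rightarrow> 'k free_alg" where
  "eval_at p a = (\<Sum>i\<le>Polynomial.degree p. scal (Polynomial.coeff p i) * a ^ i)"


section \<open>The algebra \<open>\<B>(p;q,r)\<close>\<close>

abbreviation free_ring :: "'k::field free_alg ring" where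
  "free_ring \<equiv> ring_of_type_algebra"

definition relators :: "'k::field poly \<Rightarrow> 'k \<Rightarrow> 'k \<Rightarrow> 'k free_alg set" where
  "relators p q r =
    (let x = gen GenX; y = gen GenY; z = gen GenZ in
      {x * y - eval_at p (scal q * z + scal r),
       y * x - eval_at p z,
       x * z - (scal q * z + scal r) * x,
       y * z - scal (inverse q) * (z - scal r) * y})"

definition rel_ideal :: "'k::field poly \<Rightarrow> 'k \<Rightarrow> 'k \<Rightarrow> 'k free_alg set" where
  "rel_ideal p q r = Idl\<^bsub>free_ring\<^esub> (relators p q r)"

definition B_alg :: "'k::field poly \<Rightarrow> 'k \<Rightarrow> 'k \<Rightarrow> 'k free_alg set ring" where
  "B_alg p q r = free_ring Quot (rel_ideal p q r)"

definition cls :: "'k::field poly \<Rightarrow> 'k \<Rightarrow> 'k \<Rightarrow> 'k free_alg \<Rightarrow> 'k free_alg set" where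
  "cls p q r a = rel_ideal p q r +>\<^bsub>free_ring\<^esub> a"

definition mono_x :: "'k::field poly \<Rightarrow> 'k \<Rightarrow> 'k \<Rightarrow> nat \<Rightarrow> nat \<Rightarrow> 'k free_alg set" where
  "mono_x p q r m n =
    (cls p q r (gen GenX) [^]\<^bsub>B_alg p q r\<^esub> m) \<otimes>\<^bsub>B_alg p q r\<^esub> (cls p q r (gen GenZ) [^]\<^bsub>B_alg p q r\<^esub> n)"

definition mono_y :: "'k::field poly \<Rightarrow> 'k \<Rightarrow> 'k \<Rightarrow> nat \<Rightarrow> nat \<Rightarrow> 'k free_alg set" where
  "mono_y p q r m n =
    (cls p q r (gen GenY) [^]\<^bsub>B_alg p q r\<^esub> m) \<otimes>\<^bsub>B_alg p q r\<^esub> (cls p q r (gen GenZ) [^]\<^bsub>B_alg p q r\<^esub> n)"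

text \<open>
  The scalar action on the quotient is multiplication by the class of a constant.  Functionals
  are required to be \<^const>\<open>extensional\<close> so that they are maps with domain the carrier, and
  equality of two of them is equality of such maps.
\<close>

definition linear_functionals ::
    "'k::field poly \<Rightarrow> 'k \<Rightarrow> 'k \<Rightarrow> ('k free_alg set \<Rightarrow> 'k) set" where
  "linear_functionals p q r =
    {\<phi> \<in> extensional (carrier (B_alg p q r)).
      (\<forall>a\<in>carrier (B_alg p q r). \<forall>b\<in>carrier (B_alg p q r).
          \<phi> (a \<oplus>\<^bsub>B_alg p q r\<^esub> b) = \<phi> a + \<phi> b) \<and>
      (\<forall>c. \<forall>a\<in>carrier (B_alg p q r).
          \<phi> (cls p q r (scal c) \<otimes>\<^bsub>B_alg p q r\<^esub> a) = c * \<phi> a)}"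


section \<open>The functionals \<open>\<tau>\<^sub>\<zeta>\<close>\<close>

text \<open>
  \<open>t_coeff q r n m\<close> is \<open>t\<^sup>n\<^sub>m\<close>.  It is meaningful for \<open>1 \<le> m \<le> n\<close>; with \<open>m = n - k\<close> the summation
  bound \<open>k\<close> is \<open>n - m\<close>.
\<close>

function t_coeff :: "'k::field \<Rightarrow> 'k \<Rightarrow> nat \<Rightarrow> nat \<Rightarrow> 'k" where
  "t_coeff q r n m =
    (if m = n then 1
     else if 1 \<le> m \<and> m < n then
       (\<Sum>i\<in>{1..n - m}.
          of_nat (n choose i) * (r ^ i * q ^ (n - i) / (1 - q ^ (n - i))) * t_coeff q r (n - i) m)
     else 0)"
  by pat_completeness auto
termination
  by (relation "measure (\<lambda>(q, r, n, m). n)") auto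

declare t_coeff.simps [simp del]

definition hat_tau_monom :: "'k::field \<Rightarrow> 'k \<Rightarrow> 'k \<Rightarrow> nat \<Rightarrow> 'k" where
  "hat_tau_monom q r \<zeta> n =
    (if n = 0 then 0 else 1 / (1 - q ^ n) * (\<Sum>i=1..n. t_coeff q r n i * \<zeta> ^ i))"

text \<open>The linear extension to \<open>'k[z]\<close>.\<close>

definition hat_tau :: "'k::field \<Rightarrow> 'k \<Rightarrow> 'k \<Rightarrow> 'k poly \<Rightarrow> 'k" where
  "hat_tau q r \<zeta> f = (\<Sum>n\<le>Polynomial.degree f. Polynomial.coeff f n * hat_tau_monom q r \<zeta> n)"

definition is_tau ::
    "'k::field poly \<Rightarrow> 'k \<Rightarrow> 'k \<Rightarrow> 'k \<Rightarrow> ('k free_alg set \<Rightarrow> 'k) \<Rightarrow> bool" where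
  "is_tau p q r \<zeta> \<tau> \<longleftrightarrow>
    \<tau> \<in> linear_functionals p q r \<and>
    (\<forall>m n. \<tau> (mono_x p q r m n)
        = (if m = 0 \<and> n \<noteq> 0 then hat_tau q r \<zeta> (Polynomial.monom 1 n) else 0)) \<and>
    (\<forall>m n. \<tau> (mono_y p q r m n)
        = (if m = 0 \<and> n \<noteq> 0 then hat_tau q r \<zeta> (Polynomial.monom 1 n) else 0))"

definition is_trace ::
    "'k::field poly \<Rightarrow> 'k \<Rightarrow> 'k \<Rightarrow> ('k free_alg set \<Rightarrow> 'k) \<Rightarrow> bool" where
  "is_trace p q r \<tau> \<longleftrightarrow>
    \<tau> \<in> linear_functionals p q r \<and>
    (\<forall>a\<in>carrier (B_alg p q r). \<forall>b\<in>carrier (B_alg p q r).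
        \<tau> (a \<otimes>\<^bsub>B_alg p q r\<^esub> b) = \<tau> (b \<otimes>\<^bsub>B_alg p q r\<^esub> a))"

end

theory Submission
  imports Defs
begin

text \<open>
  Write \<open>\<sigma>\<close> for the automorphism \<open>z \<mapsto> q z + r\<close> of the polynomial ring.  The relations say that \<open>x\<close>
  acts like the variable \<open>X\<close> of the skew Laurent ring, in which \<open>X f = \<sigma>(f) X\<close>, and \<open>y\<close> like
  \<open>p X\<^sup>-\<^sup>1\<close>.  In that ring every word in \<open>x, y, z\<close> is of the form \<open>c X\<^sup>d\<close> with a polynomial \<open>c\<close>, and
  \<open>\<tau>\<^sub>\<zeta>\<close> is \<open>T\<close> of the coefficient of \<open>X\<^sup>0\<close>, where \<open>T\<close> abbreviates \<open>hat_tau q r \<zeta>\<close>.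

  The coefficients \<open>t\<^sup>n\<^sub>i\<close> are made for the identity
  \<open>T(h) - T(\<sigma>(h)) = h(\<zeta>) - h(0)\<close> on polynomials (\<open>hat_tau_diff_substitution\<close>).  So
  \<open>T\<close> does not distinguish \<open>h\<close> from \<open>\<sigma>(h)\<close> as soon as \<open>h\<close> vanishes at \<open>0\<close> and \<open>\<zeta>\<close>, in particular
  when \<open>p\<close> divides \<open>h\<close>.

  The trace property reduces to moving the last letter of a word to its front
  (\<open>word_trace_rotate\<close>).  For words of total degree \<open>0\<close> this leaves the coefficient unchanged when
  the letter is \<open>z\<close> and changes it by \<open>\<sigma>\<close> or its inverse when the letter is \<open>x\<close> or \<open>y\<close>; in the
  last two cases the factor \<open>p\<close> that comes with each \<open>y\<close> makes it vanish at \<open>0\<close> and \<open>\<zeta>\<close>.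

  The functional thus obtained on the free algebra is a trace that kills every product
  of a relator with something, hence the ideal of relations, so it descends to the quotient.
  This gives existence without first proving that the monomials are linearly independent.
  Uniqueness only needs that they span (\<open>ideal_monomials_span\<close>).
\<close>

section \<open>The functional on polynomials\<close>

lemma hat_tau_eq_sum:
  assumes "degree f \<le> N"
  shows "hat_tau q r \<zeta> f = (\<Sum>n\<le>N. coeff f n * hat_tau_monom q r \<zeta> n)"
  unfolding hat_tau_def
  by (rule sum.mono_neutral_left) (use assms in \<open>auto simp: coeff_eq_0\<close>)

lemma hat_tau_add: "hat_tau q r \<zeta> (f + g) = hat_tau q r \<zeta> f + hat_tau q r \<zeta> g"
proof -
  define N where "N = max (degree f) (degree g)"
  have "degree f \<le> N" "degree g \<le> N" "degree (f + g) \<le> N"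
    by (simp_all add: N_def degree_add_le)
  then show ?thesis
    by (simp add: hat_tau_eq_sum[where N = N] sum.distrib algebra_simps)
qed

lemma hat_tau_smult: "hat_tau q r \<zeta> (smult c f) = c * hat_tau q r \<zeta> f"
  by (simp add: hat_tau_eq_sum[OF degree_smult_le] hat_tau_def sum_distrib_left mult.assoc)

lemma hat_tau_0 [simp]: "hat_tau q r \<zeta> 0 = 0"
  by (simp add: hat_tau_def hat_tau_monom_def)

lemma hat_tau_sum: "hat_tau q r \<zeta> (sum f A) = (\<Sum>i\<in>A. hat_tau q r \<zeta> (f i))"
  by (induction A rule: infinite_finite_induct) (simp_all add: hat_tau_add)

lemma hat_tau_monom_1: "hat_tau q r \<zeta> (monom 1 n) = hat_tau_monom q r \<zeta> n"
proof -
  have "hat_tau q r \<zeta> (monom 1 n)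
      = (\<Sum>i\<le>n. if i = n then hat_tau_monom q r \<zeta> n else 0)"
    unfolding hat_tau_eq_sum[OF degree_monom_le] by (intro sum.cong) auto
  then show ?thesis by simp
qed

lemma pcompose_sum_coeff: "pcompose f s = (\<Sum>i\<le>degree f. smult (coeff f i) (s ^ i))"
  for f s :: "'k::field_char_0 poly"
proof -
  have "poly (pcompose f s) t = poly (\<Sum>i\<le>degree f. smult (coeff f i) (s ^ i)) t" for t
    by (simp add: poly_pcompose poly_sum poly_power) (simp add: poly_altdef)
  then show ?thesis by (simp add: poly_eq_poly_eq_iff[symmetric] fun_eq_iff)
qed

lemma t_coeff_recursion:
  assumes "1 \<le> j" "j < n"
  shows "t_coeff q r n j =
    (\<Sum>k\<in>{j..<n}. of_nat (n choose k) * (r ^ (n - k) * q ^ k / (1 - q ^ k)) * t_coeff q r k j)"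
proof -
  have "t_coeff q r n j = (\<Sum>i\<in>{1..n - j}.
      of_nat (n choose i) * (r ^ i * q ^ (n - i) / (1 - q ^ (n - i))) * t_coeff q r (n - i) j)"
    using assms by (subst t_coeff.simps) auto
  also have "\<dots> = (\<Sum>k\<in>{j..<n}.
      of_nat (n choose k) * (r ^ (n - k) * q ^ k / (1 - q ^ k)) * t_coeff q r k j)"
    by (rule sum.reindex_bij_witness[where i = "\<lambda>k. n - k" and j = "\<lambda>i. n - i"])
       (use assms in \<open>auto simp: binomial_symmetric[symmetric]\<close>)
  finally show ?thesis .
qed

text \<open>
  The defining recursion of the \<open>t\<^sup>n\<^sub>j\<close>, summed against \<open>\<zeta>\<^sup>j\<close>: the right-hand side is \<open>hat_tau\<close> of
  \<open>(q z + r)\<^sup>n\<close> in binomial expansion, plus the term \<open>t\<^sup>n\<^sub>n \<zeta>\<^sup>n\<close>, which the recursion leaves out.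
\<close>

lemma hat_tau_monom_recursion:
  fixes q r \<zeta> :: "'k::field_char_0"
  assumes "n \<ge> 1" and nroot: "\<forall>n\<ge>1. q ^ n \<noteq> 1"
  shows "hat_tau_monom q r \<zeta> n
    = (\<Sum>k\<le>n. of_nat (n choose k) * q ^ k * r ^ (n - k) * hat_tau_monom q r \<zeta> k) + \<zeta> ^ n"
proof -
  define b where "b k = of_nat (n choose k) * q ^ k * r ^ (n - k)" for k
  define s where "s k = (\<Sum>j=1..k. t_coeff q r k j * \<zeta> ^ j)" for k
  have H: "hat_tau_monom q r \<zeta> k = s k / (1 - q ^ k)" if "k \<ge> 1" for k
    using that by (simp add: hat_tau_monom_def s_def)
  have "(\<Sum>j\<in>{1..<n}. t_coeff q r n j * \<zeta> ^ j)
      = (\<Sum>j\<in>{1..<n}. \<Sum>k\<in>{j..<n}. b k / (1 - q ^ k) * t_coeff q r k j * \<zeta> ^ j)"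
    by (rule sum.cong)
       (auto simp: t_coeff_recursion[of _ n] b_def sum_distrib_left mult_ac intro!: sum.cong)
  also have "\<dots> = (\<Sum>k\<in>{1..<n}. \<Sum>j\<in>{1..k}. b k / (1 - q ^ k) * t_coeff q r k j * \<zeta> ^ j)"
    \<comment> \<open>exchange of summation over the triangle \<open>1 \<le> j \<le> k < n\<close>\<close>
    unfolding sum.Sigma[OF finite_atLeastLessThan ballI[OF finite_atLeastLessThan]]
      sum.Sigma[OF finite_atLeastLessThan ballI[OF finite_atLeastAtMost]]
    by (rule sum.reindex_bij_witness[where i = "\<lambda>(k, j). (j, k)" and j = "\<lambda>(j, k). (k, j)"]) auto
  also have "\<dots> = (\<Sum>k\<in>{1..<n}. b k * hat_tau_monom q r \<zeta> k)"
    by (intro sum.cong) (auto simp: H s_def sum_distrib_left mult_ac sum_divide_distrib)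
  finally have low: "(\<Sum>j\<in>{1..<n}. t_coeff q r n j * \<zeta> ^ j)
      = (\<Sum>k\<in>{1..<n}. b k * hat_tau_monom q r \<zeta> k)" .
  have "{1..n} = insert n {1..<n}" using assms(1) by auto
  then have "s n = (\<Sum>k\<in>{1..<n}. b k * hat_tau_monom q r \<zeta> k) + \<zeta> ^ n"
    unfolding low[symmetric] by (simp add: s_def t_coeff.simps[of q r n n])
  moreover have "{..n} = insert n (insert 0 {1..<n})" using assms(1) by auto
  then have "(\<Sum>k\<le>n. b k * hat_tau_monom q r \<zeta> k)
      = q ^ n * hat_tau_monom q r \<zeta> n + (\<Sum>k\<in>{1..<n}. b k * hat_tau_monom q r \<zeta> k)"
    using assms(1) by (simp add: b_def hat_tau_monom_def[of q r \<zeta> 0])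
  moreover have "(1 - q ^ n) * hat_tau_monom q r \<zeta> n = s n"
    using assms H[of n] by simp
  ultimately show ?thesis by (simp add: b_def algebra_simps)
qed

text \<open>
  On \<open>z\<^sup>n\<close> with \<open>n \<ge> 1\<close> this is \<open>hat_tau_monom_recursion\<close>; for \<open>n = 0\<close> the two evaluations
  cancel.  The general case follows by linearity.
\<close>

lemma hat_tau_diff_substitution:
  fixes q r \<zeta> :: "'k::field_char_0"
  assumes "\<forall>n\<ge>1. q ^ n \<noteq> 1"
  shows "hat_tau q r \<zeta> h = hat_tau q r \<zeta> (pcompose h [:r, q:]) + poly h \<zeta> - poly h 0"
proof -
  have monom: "hat_tau_monom q r \<zeta> n = hat_tau q r \<zeta> ([:r, q:] ^ n) + \<zeta> ^ n - 0 ^ n" for n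
  proof (cases "n = 0")
    case True
    then show ?thesis
      by (simp add: hat_tau_monom_def hat_tau_def)
  next
    case False
    have "[:r, q:] = monom q 1 + [:r:]" by (simp add: monom_altdef)
    then have "[:r, q:] ^ n
        = (\<Sum>k\<le>n. smult (of_nat (n choose k) * q ^ k * r ^ (n - k)) (monom 1 k))"
      by (simp add: binomial_ring monom_power poly_const_pow of_nat_poly smult_monom mult_ac)
    then have "hat_tau q r \<zeta> ([:r, q:] ^ n)
        = (\<Sum>k\<le>n. of_nat (n choose k) * q ^ k * r ^ (n - k) * hat_tau_monom q r \<zeta> k)"
      by (simp only: hat_tau_sum hat_tau_smult hat_tau_monom_1)
    with False hat_tau_monom_recursion[of n q r \<zeta>] assms show ?thesis by simp
  qed
  have "hat_tau q r \<zeta> h = (\<Sum>n\<le>degree h. coeff h n * hat_tau_monom q r \<zeta> n)"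
    by (simp add: hat_tau_def)
  also have "\<dots> = (\<Sum>n\<le>degree h. coeff h n * hat_tau q r \<zeta> ([:r, q:] ^ n))
      + (\<Sum>n\<le>degree h. coeff h n * \<zeta> ^ n) - (\<Sum>n\<le>degree h. coeff h n * 0 ^ n)"
    by (subst monom) (simp add: sum.distrib sum_subtractf algebra_simps)
  also have "\<dots> = hat_tau q r \<zeta> (pcompose h [:r, q:]) + poly h \<zeta> - poly h 0"
    by (simp only: pcompose_sum_coeff[of h] hat_tau_sum hat_tau_smult poly_altdef[of h])
  finally show ?thesis .
qed

section \<open>The free algebra\<close>

lemma free_alg_induct [case_names single add]:
  fixes a :: "'k::field free_alg"
  assumes single: "\<And>w c. P (Poly_Mapping.single w c)"
    and add: "\<And>a b. P a \<Longrightarrow> P b \<Longrightarrow> P (a + b)"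
  shows "P a"
proof (induction a rule: update_induct)
  case const
  then show ?case using single[of 0 0] by simp
next
  case (update a w c)
  have "Poly_Mapping.update w c a = a + Poly_Mapping.single w c"
    using update.hyps
    by (intro poly_mapping_eqI) (auto simp: lookup_update lookup_add lookup_single in_keys_iff when_def)
  then show ?case using add[OF update.IH single] by simp
qed

lemma gen_mult_single: "gen g * Poly_Mapping.single w c = Poly_Mapping.single (Word (g # letters w)) c"
  by (simp add: gen_def mult_single plus_word_def)

lemma scal_mult_single: "scal c * Poly_Mapping.single w d = Poly_Mapping.single w (c * d)"
  by (simp add: scal_def mult_single)

text \<open>
  Scalars are central, although the algebra is not commutative: \<open>scal c\<close> lives on the empty word.
\<close>

lemma scal_commute: "scal c * a = a * scal c"
  by (induction a rule: free_alg_induct)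
     (simp_all add: distrib_left distrib_right scal_def mult_single mult.commute)

lemma scal_mult: "scal (c * d) = scal c * scal d"
  by (simp add: scal_def mult_single)

lemma scal_0 [simp]: "scal 0 = 0"
  and scal_1 [simp]: "scal 1 = 1"
  by (simp_all add: scal_def)

lemma scal_uminus: "scal (- c) = - scal c"
  by (simp add: scal_def single_uminus)

definition lin_ext :: "(word \<Rightarrow> 'k poly) \<Rightarrow> 'k::field free_alg \<Rightarrow> 'k poly" where
  "lin_ext f a = (\<Sum>w\<in>Poly_Mapping.keys a. smult (Poly_Mapping.lookup a w) (f w))"

lemma lin_ext_eq_sum:
  assumes "finite A" "Poly_Mapping.keys a \<subseteq> A"
  shows "lin_ext f a = (\<Sum>w\<in>A. smult (Poly_Mapping.lookup a w) (f w))"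
  unfolding lin_ext_def
  by (rule sum.mono_neutral_left) (use assms in \<open>auto simp: in_keys_iff\<close>)

lemma lin_ext_add: "lin_ext f (a + b) = lin_ext f a + lin_ext f b"
proof -
  define A where "A = Poly_Mapping.keys a \<union> Poly_Mapping.keys b"
  have "finite A" "Poly_Mapping.keys a \<subseteq> A" "Poly_Mapping.keys b \<subseteq> A"
    "Poly_Mapping.keys (a + b) \<subseteq> A"
    using keys_add[of a b] by (auto simp: A_def)
  then show ?thesis
    by (simp add: lin_ext_eq_sum[where A = A] lookup_add smult_add_left sum.distrib)
qed

lemma lin_ext_single [simp]: "lin_ext f (Poly_Mapping.single w c) = smult c (f w)"
  by (subst lin_ext_eq_sum[where A = "{w}"]) auto

section \<open>The action on skew Laurent polynomials\<close>

locale gen_weyl =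
  fixes p :: "'k::field_char_0 poly" and q r :: 'k
  assumes q_nonzero: "q \<noteq> 0"
begin

abbreviation "gx \<equiv> gen GenX :: 'k free_alg"
abbreviation "gy \<equiv> gen GenY :: 'k free_alg"
abbreviation "gz \<equiv> gen GenZ :: 'k free_alg"

definition shift :: "'k poly" where "shift = [:r, q:]"
definition unshift :: "'k poly" where "unshift = [:- r / q, inverse q:]"

lemma poly_shift [simp]: "poly shift s = q * s + r"
  and poly_unshift [simp]: "poly unshift s = (s - r) / q"
  using q_nonzero by (simp_all add: shift_def unshift_def field_simps)

fun wdeg :: "gen list \<Rightarrow> int" where
  "wdeg [] = 0"
| "wdeg (GenX # w) = wdeg w + 1"
| "wdeg (GenY # w) = wdeg w - 1"
| "wdeg (GenZ # w) = wdeg w"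

text \<open>
  The word \<open>w\<close> is sent to \<open>wcoef w \<cdot> X\<^bsup>wdeg w\<^esup>\<close> in the skew Laurent ring by \<open>x \<mapsto> X\<close>,
  \<open>y \<mapsto> p X\<^sup>-\<^sup>1\<close>, \<open>z \<mapsto> z\<close>.
\<close>

fun wcoef :: "gen list \<Rightarrow> 'k poly" where
  "wcoef [] = 1"
| "wcoef (GenX # w) = pcompose (wcoef w) shift"
| "wcoef (GenY # w) = p * pcompose (wcoef w) unshift"
| "wcoef (GenZ # w) = [:0, 1:] * wcoef w"

text \<open>
  The coefficient of \<open>X\<^sup>d\<close> in the image of an element of the free algebra.  Working with these
  coefficients makes it unnecessary to construct the skew Laurent ring as a type: its
  multiplication enters only through the effect of left multiplication by a generator.
\<close>

definition deg_part :: "int \<Rightarrow> 'k free_alg \<Rightarrow> 'k poly" where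
  "deg_part d = lin_ext (\<lambda>w. if wdeg (letters w) = d then wcoef (letters w) else 0)"

lemma deg_part_add: "deg_part d (a + b) = deg_part d a + deg_part d b"
  by (simp add: deg_part_def lin_ext_add)

lemma deg_part_single: "deg_part d (Poly_Mapping.single w c)
    = smult c (if wdeg (letters w) = d then wcoef (letters w) else 0)"
  by (simp add: deg_part_def)

lemma deg_part_0 [simp]: "deg_part d 0 = 0"
  using deg_part_single[of d 0 0] by simp

lemma deg_part_diff: "deg_part d (a - b) = deg_part d a - deg_part d b"
  using deg_part_add[of d "a - b" b] by simp

lemma deg_part_sum: "deg_part d (sum f A) = (\<Sum>i\<in>A. deg_part d (f i))"
  by (induction A rule: infinite_finite_induct) (simp_all add: deg_part_add)

lemma deg_part_one: "deg_part d 1 = (if d = 0 then 1 else 0)"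
  using deg_part_single[of d 0 1] by (simp add: zero_word_def[symmetric]) (simp add: zero_word_def)

lemma deg_part_scal_mult: "deg_part d (scal c * a) = smult c (deg_part d a)"
  by (induction a rule: free_alg_induct)
     (simp_all add: distrib_left deg_part_add smult_add_right scal_mult_single deg_part_single)

lemma deg_part_x_mult: "deg_part d (gx * a) = pcompose (deg_part (d - 1) a) shift"
  by (induction a rule: free_alg_induct)
     (auto simp: distrib_left deg_part_add pcompose_add gen_mult_single deg_part_single pcompose_smult)

lemma deg_part_y_mult: "deg_part d (gy * a) = p * pcompose (deg_part (d + 1) a) unshift"
  by (induction a rule: free_alg_induct)
     (auto simp: distrib_left deg_part_add pcompose_add gen_mult_single deg_part_single pcompose_smult)

lemma deg_part_z_mult: "deg_part d (gz * a) = [:0, 1:] * deg_part d a"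
  by (induction a rule: free_alg_induct)
     (auto simp: distrib_left deg_part_add gen_mult_single deg_part_single smult_add_right)

lemma deg_part_eval_at_mult:
  assumes "\<And>a. deg_part d (b * a) = s * deg_part d a"
  shows "deg_part d (eval_at f b * a) = pcompose f s * deg_part d a"
proof -
  have "deg_part d (b ^ i * a) = s ^ i * deg_part d a" for i a
    by (induction i arbitrary: a) (simp_all add: assms mult.assoc)
  then show ?thesis
    by (simp add: eval_at_def sum_distrib_right deg_part_sum mult.assoc deg_part_scal_mult
        pcompose_sum_coeff[of f])
qed

text \<open>
  The images of the generators satisfy the relations.  The two relations between \<open>x\<close> and \<open>y\<close>
  amount to \<open>X p X\<^sup>-\<^sup>1 = \<sigma>(p)\<close> and \<open>p X\<^sup>-\<^sup>1 X = p\<close>.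
\<close>

lemma deg_part_relator_mult:
  assumes "a \<in> relators p q r"
  shows "deg_part d (a * b) = 0"
proof -
  have qzr: "deg_part d ((scal q * gz + scal r) * b) = shift * deg_part d b" for d b
    by (simp add: distrib_right deg_part_add deg_part_scal_mult mult.assoc deg_part_z_mult shift_def)
  have zr: "deg_part d ((scal (inverse q) * (gz - scal r)) * b) = unshift * deg_part d b" for d b
    using q_nonzero
    by (simp add: right_diff_distrib left_diff_distrib deg_part_diff deg_part_scal_mult mult.assoc
        deg_part_z_mult unshift_def smult_diff_right divide_inverse mult.commute)
  consider
      "a = gx * gy - eval_at p (scal q * gz + scal r)"
    | "a = gy * gx - eval_at p gz"
    | "a = gx * gz - (scal q * gz + scal r) * gx"
    | "a = gy * gz - scal (inverse q) * (gz - scal r) * gy"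
    using assms by (auto simp: relators_def Let_def)
  then show ?thesis
  proof cases
    case 1
    have "pcompose unshift shift = [:0, 1:]"
      using q_nonzero by (simp add: unshift_def shift_def pcompose_pCons divide_inverse mult.commute)
    then show ?thesis
      using 1 by (simp add: left_diff_distrib deg_part_diff mult.assoc deg_part_x_mult deg_part_y_mult
          deg_part_eval_at_mult[OF qzr] pcompose_mult pcompose_assoc[symmetric])
  next
    case 2
    have "pcompose shift unshift = [:0, 1:]"
      using q_nonzero by (simp add: unshift_def shift_def pcompose_pCons divide_inverse mult.commute)
    then show ?thesis
      using 2 by (simp add: left_diff_distrib deg_part_diff mult.assoc deg_part_x_mult deg_part_y_mult
          deg_part_eval_at_mult[OF deg_part_z_mult] pcompose_assoc[symmetric])
  next
    case 3
    have "pcompose [:0, 1:] shift = shift" by (simp add: pcompose_pCons)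
    then show ?thesis
      using 3 by (simp add: left_diff_distrib deg_part_diff mult.assoc qzr deg_part_x_mult deg_part_z_mult
          pcompose_mult del: mult_pCons_left)
  next
    case 4
    have "pcompose [:0, 1:] unshift = unshift" by (simp add: pcompose_pCons)
    then show ?thesis
      using 4 by (simp add: left_diff_distrib[of _ _ b] deg_part_diff mult.assoc[of _ gy b]
          mult.assoc[of gy _ b] zr deg_part_y_mult deg_part_z_mult pcompose_mult mult.left_commute
          del: mult_pCons_left)
  qed
qed

section \<open>The trace property on words\<close>

lemma wdeg_append: "wdeg (u @ v) = wdeg u + wdeg v"
  by (induction u rule: wdeg.induct) simp_all

end

locale gen_weyl_trace = gen_weyl +
  fixes \<zeta> :: 'a
  assumes not_root_of_unity: "\<forall>n\<ge>1. q ^ n \<noteq> 1"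
    and root_0: "poly p 0 = 0" and root_zeta: "poly p \<zeta> = 0"
begin

text \<open>
  The \<open>d\<close>-th iterate of \<open>s \<mapsto> q s + r\<close> for an integer \<open>d\<close>, in closed form: as \<open>q \<noteq> 1\<close>, the map is a
  dilation by \<open>q\<close> about its fixed point \<open>r / (1 - q)\<close>.
\<close>

definition affine_pow :: "int \<Rightarrow> 'a \<Rightarrow> 'a" where
  "affine_pow d s = r / (1 - q) + q powi d * (s - r / (1 - q))"

lemma q_neq_1: "q \<noteq> 1"
  using not_root_of_unity[rule_format, of 1] by simp

lemma affine_pow_0 [simp]: "affine_pow 0 s = s"
  by (simp add: affine_pow_def)

lemma affine_pow_shift: "affine_pow d (q * s + r) = affine_pow (d + 1) s"
  and affine_pow_step: "q * affine_pow d s + r = affine_pow (d + 1) s"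
proof -
  define c where "c = r / (1 - q)"
  have pow: "affine_pow d s = c + q powi d * (s - c)" for d s
    by (simp add: affine_pow_def c_def)
  have "(1 - q) * c = r" using q_neq_1 by (simp add: c_def)
  then have "r = c - q * c" by (simp add: left_diff_distrib)
  then have "q * s + r = c + q * (s - c)" for s by (simp add: right_diff_distrib)
  moreover have "q powi (d + 1) = q * q powi d"
    using q_nonzero by (simp add: power_int_add_1 mult.commute)
  ultimately show "affine_pow d (q * s + r) = affine_pow (d + 1) s"
    and "q * affine_pow d s + r = affine_pow (d + 1) s"
    by (simp_all add: pow)
qed

lemma affine_pow_1: "affine_pow 1 s = q * s + r"
  using affine_pow_step[of 0 s] by simp

lemma affine_pow_unshift: "affine_pow d ((s - r) / q) = affine_pow (d - 1) s"
  using affine_pow_shift[of "d - 1" "(s - r) / q"] q_nonzero by simp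

lemma affine_pow_back: "(affine_pow d s - r) / q = affine_pow (d - 1) s"
  using affine_pow_step[of "d - 1" s] q_nonzero by (simp add: field_simps)

text \<open>
  The product rule \<open>c X\<^sup>d \<cdot> c' X\<^bsup>d'\<^esup> = c \<sigma>\<^sup>d(c') X\<^bsup>d+d'\<^esup>\<close>, evaluated at a point.
\<close>

lemma poly_wcoef_append:
  "poly (wcoef (u @ v)) s = poly (wcoef u) s * poly (wcoef v) (affine_pow (wdeg u) s)"
  by (induction u arbitrary: s rule: wcoef.induct)
     (simp_all add: poly_pcompose affine_pow_shift affine_pow_unshift add.commute[of 1])

text \<open>
  A word of degree \<open>-n < 0\<close> has \<open>n\<close> more letters \<open>y\<close> than \<open>x\<close>, so its coefficient is divisible
  by \<open>p \<sigma>\<^sup>-\<^sup>1(p) \<dots> \<sigma>\<^bsup>-(n-1)\<^esup>(p)\<close>.  This is stated through the roots \<open>affine_pow j s\<close> of these factors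
  at a root \<open>s\<close> of \<open>p\<close>.  A leading \<open>x\<close> or \<open>y\<close> shifts \<open>j\<close>, so the induction has to follow all of these
  roots at once, even for \<open>j = 0\<close>.
\<close>

lemma wcoef_negative_degree_root:
  assumes "poly p s = 0" "0 \<le> j" "j < - wdeg u"
  shows "poly (wcoef u) (affine_pow j s) = 0"
  using assms(2,3)
proof (induction u arbitrary: j rule: wcoef.induct)
  case (2 w)
  then show ?case by (simp add: poly_pcompose affine_pow_step)
next
  case (3 w)
  show ?case
  proof (cases "j = 0")
    case True
    then show ?thesis using assms(1) by simp
  next
    case False
    with 3 show ?thesis by (simp add: poly_pcompose affine_pow_back)
  qed
qed simp_all

definition word_trace :: "gen list \<Rightarrow> 'a" where
  "word_trace w = (if wdeg w = 0 then hat_tau q r \<zeta> (wcoef w) else 0)"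

lemma hat_tau_shift_invariant:
  assumes "poly h 0 = 0" "poly h \<zeta> = 0"
  shows "hat_tau q r \<zeta> (pcompose h shift) = hat_tau q r \<zeta> h"
  using hat_tau_diff_substitution[OF not_root_of_unity, of r \<zeta> h] assms
  by (simp add: shift_def)

text \<open>
  Only words of total degree \<open>0\<close> matter.  If the letter is \<open>x\<close>, then \<open>u\<close> has degree \<open>-1\<close> and the two
  coefficients are \<open>c\<close> and \<open>\<sigma>(c)\<close>, where \<open>c\<close> vanishes at \<open>0\<close> and \<open>\<zeta>\<close> by the preceding lemma.  If it is
  \<open>y\<close>, the coefficients are \<open>\<sigma>(h)\<close> and \<open>h\<close> with \<open>h\<close> a multiple of \<open>p\<close>.
\<close>

lemma word_trace_rotate: "word_trace (u @ [g]) = word_trace (g # u)"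
proof (cases g)
  case GenX
  have "wcoef (u @ [GenX]) = wcoef u"
    by (simp add: poly_eq_poly_eq_iff[symmetric] fun_eq_iff poly_wcoef_append pcompose_1)
  moreover have "hat_tau q r \<zeta> (pcompose (wcoef u) shift) = hat_tau q r \<zeta> (wcoef u)"
    if "wdeg u = -1"
    using that wcoef_negative_degree_root[of _ 0 u] root_0 root_zeta
    by (intro hat_tau_shift_invariant) auto
  ultimately show ?thesis using GenX by (auto simp: word_trace_def wdeg_append)
next
  case GenY
  define h where "h = wcoef (GenY # u)"
  have "wcoef (u @ [GenY]) = pcompose h shift" if "wdeg u = 1"
    using that q_nonzero
    by (simp add: h_def poly_eq_poly_eq_iff[symmetric] fun_eq_iff poly_wcoef_append pcompose_1
        poly_pcompose affine_pow_1)
  moreover have "hat_tau q r \<zeta> (pcompose h shift) = hat_tau q r \<zeta> h"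
    using root_0 root_zeta by (intro hat_tau_shift_invariant) (simp_all add: h_def)
  ultimately show ?thesis using GenY by (auto simp: word_trace_def wdeg_append h_def)
next
  case GenZ
  have "wcoef (u @ [GenZ]) = wcoef (GenZ # u)" if "wdeg u = 0"
    using that by (simp add: poly_eq_poly_eq_iff[symmetric] fun_eq_iff poly_wcoef_append)
  then show ?thesis using GenZ by (auto simp: word_trace_def wdeg_append)
qed

lemma word_trace_commute: "word_trace (u @ v) = word_trace (v @ u)"
proof (induction u arbitrary: v)
  case (Cons g u)
  have "word_trace (g # u @ v) = word_trace ((u @ v) @ [g])" by (rule word_trace_rotate[symmetric])
  also have "\<dots> = word_trace (u @ (v @ [g]))" by simp
  also have "\<dots> = word_trace ((v @ [g]) @ u)" by (rule Cons.IH)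
  finally show ?case by simp
qed simp

definition free_trace :: "'a free_alg \<Rightarrow> 'a" where
  "free_trace a = hat_tau q r \<zeta> (deg_part 0 a)"

lemma free_trace_add: "free_trace (a + b) = free_trace a + free_trace b"
  by (simp add: free_trace_def deg_part_add hat_tau_add)

lemma free_trace_0 [simp]: "free_trace 0 = 0"
  by (simp add: free_trace_def)

lemma free_trace_scal_mult: "free_trace (scal c * a) = c * free_trace a"
  by (simp add: free_trace_def deg_part_scal_mult hat_tau_smult)

lemma free_trace_single: "free_trace (Poly_Mapping.single w c) = c * word_trace (letters w)"
  by (simp add: free_trace_def deg_part_single word_trace_def hat_tau_smult)

lemma free_trace_commute: "free_trace (a * b) = free_trace (b * a)"
proof (induction a rule: free_alg_induct)
  case (single u c)
  show ?case
    by (induction b rule: free_alg_induct)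
       (simp_all add: mult_single free_trace_single plus_word_def word_trace_commute mult.commute
         distrib_left distrib_right free_trace_add)
qed (simp add: distrib_left distrib_right free_trace_add)

end

section \<open>The quotient algebra\<close>

lemma free_ring_simps [simp]:
  "carrier free_ring = UNIV" "monoid.mult free_ring = (*)" "one free_ring = 1"
  "ring.zero free_ring = 0" "add free_ring = (+)"
  by (simp_all add: ring_of_type_algebra_def fun_eq_iff)

text \<open>
  The free algebra is not commutative, so \<open>ring_from_type_algebra\<close> does not apply to it.
\<close>

lemma ring_free_ring: "ring (free_ring :: 'k::field free_alg ring)"
proof -
  have "\<exists>y. x + y = 0" for x :: "'k free_alg"
    using add.right_inverse by blast
  then show ?thesis
    unfolding ring_of_type_algebra_def using add.right_inverse
    by unfold_locales (auto simp: algebra_simps Units_def)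
qed

lemma ideal_free_ringI:
  fixes J :: "'k::field free_alg set"
  assumes "0 \<in> J" "\<And>a b. a \<in> J \<Longrightarrow> b \<in> J \<Longrightarrow> a + b \<in> J"
    "\<And>a b. a \<in> J \<Longrightarrow> b * a \<in> J" "\<And>a b. a \<in> J \<Longrightarrow> a * b \<in> J"
  shows "ideal J free_ring"
proof -
  interpret R: ring "free_ring :: 'k free_alg ring" by (rule ring_free_ring)
  have neg: "\<ominus>\<^bsub>free_ring\<^esub> a = - a" for a :: "'k free_alg"
    by (rule R.minus_equality) simp_all
  have "- a \<in> J" if "a \<in> J" for a using assms(3)[OF that, of "-1"] by simp
  then have "subgroup J (add_monoid free_ring)"
    using assms neg unfolding a_inv_def by (intro subgroup.intro) simp_all
  then show ?thesis by (intro idealI ring_free_ring) (use assms in auto)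
qed

lemma ideal_rel_ideal: "ideal (rel_ideal p q r) free_ring"
  unfolding rel_ideal_def by (rule ring.genideal_ideal[OF ring_free_ring]) simp

lemma relators_subset_rel_ideal: "relators p q r \<subseteq> rel_ideal p q r"
  unfolding rel_ideal_def by (rule ring.genideal_self[OF ring_free_ring]) simp

lemma rel_ideal_add: "a \<in> rel_ideal p q r \<Longrightarrow> b \<in> rel_ideal p q r \<Longrightarrow> a + b \<in> rel_ideal p q r"
  using additive_subgroup.a_closed[OF ideal.axioms(1)[OF ideal_rel_ideal]] by fastforce

lemma rel_ideal_mult_left: "a \<in> rel_ideal p q r \<Longrightarrow> b * a \<in> rel_ideal p q r"
  using ideal.I_l_closed[OF ideal_rel_ideal] by fastforce

lemma rel_ideal_mult_right: "a \<in> rel_ideal p q r \<Longrightarrow> a * b \<in> rel_ideal p q r"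
  using ideal.I_r_closed[OF ideal_rel_ideal] by fastforce

lemma rel_ideal_0: "0 \<in> rel_ideal p q r"
  using additive_subgroup.zero_closed[OF ideal.axioms(1)[OF ideal_rel_ideal]] by fastforce

lemma rel_ideal_uminus: "a \<in> rel_ideal p q r \<Longrightarrow> - a \<in> rel_ideal p q r"
  using rel_ideal_mult_left[of a p q r "-1"] by simp

lemma cls_eq_iff: "cls p q r a = cls p q r b \<longleftrightarrow> a - b \<in> rel_ideal p q r"
proof -
  have cls: "cls p q r a = (\<lambda>i. i + a) ` rel_ideal p q r" for a
    by (auto simp: cls_def a_r_coset_def')
  have sub: "cls p q r a \<subseteq> cls p q r b" if "a - b \<in> rel_ideal p q r" for a b
  proof -
    have "i + a = (i + (a - b)) + b" for i by simp
    with rel_ideal_add[OF _ that] show ?thesis unfolding cls by blast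
  qed
  show ?thesis
  proof
    assume eq: "cls p q r a = cls p q r b"
    have "0 + a \<in> cls p q r a" unfolding cls using rel_ideal_0 by blast
    then obtain i where "i \<in> rel_ideal p q r" "a = i + b" unfolding eq unfolding cls by auto
    then show "a - b \<in> rel_ideal p q r" by simp
  next
    assume "a - b \<in> rel_ideal p q r"
    with rel_ideal_uminus[OF this] show "cls p q r a = cls p q r b"
      using sub[of a b] sub[of b a] by simp
  qed
qed

lemma carrier_B_alg: "carrier (B_alg p q r) = range (cls p q r)"
  by (auto simp: B_alg_def FactRing_def A_RCOSETS_def' cls_def)

lemma cls_hom: "cls p q r \<in> ring_hom free_ring (B_alg p q r)"
  unfolding B_alg_def using ideal.rcos_ring_hom[OF ideal_rel_ideal] by (simp add: cls_def[abs_def])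

lemma cls_add: "cls p q r a \<oplus>\<^bsub>B_alg p q r\<^esub> cls p q r b = cls p q r (a + b)"
  using ring_hom_add[OF cls_hom] by fastforce

lemma cls_mult: "cls p q r a \<otimes>\<^bsub>B_alg p q r\<^esub> cls p q r b = cls p q r (a * b)"
  using ring_hom_mult[OF cls_hom] by fastforce

lemma cls_power: "cls p q r a [^]\<^bsub>B_alg p q r\<^esub> (n::nat) = cls p q r (a ^ n)"
proof (induction n)
  case 0
  then show ?case using ring_hom_one[OF cls_hom, of p q r] by (simp add: nat_pow_def)
next
  case (Suc n)
  then show ?case by (simp add: nat_pow_def cls_mult power_Suc2 del: power_Suc)
qed

lemma mono_x_cls: "mono_x p q r m n = cls p q r (gen GenX ^ m * gen GenZ ^ n)"
  and mono_y_cls: "mono_y p q r m n = cls p q r (gen GenY ^ m * gen GenZ ^ n)"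
  by (simp_all add: mono_x_def mono_y_def cls_power cls_mult)

text \<open>
  From here on the quotient is accessed through representatives, so that all computations
  take place in the free algebra.
\<close>

lemma linear_functionals_iff:
  "\<phi> \<in> linear_functionals p q r \<longleftrightarrow>
    \<phi> \<in> extensional (range (cls p q r)) \<and>
    (\<forall>a b. \<phi> (cls p q r (a + b)) = \<phi> (cls p q r a) + \<phi> (cls p q r b)) \<and>
    (\<forall>c a. \<phi> (cls p q r (scal c * a)) = c * \<phi> (cls p q r a))"
  by (auto simp: linear_functionals_def carrier_B_alg cls_add cls_mult)

lemma is_trace_iff:
  "is_trace p q r \<phi> \<longleftrightarrow> \<phi> \<in> linear_functionals p q r \<and>
    (\<forall>a b. \<phi> (cls p q r (a * b)) = \<phi> (cls p q r (b * a)))"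
  by (auto simp: is_trace_def carrier_B_alg cls_mult)

section \<open>The monomials span\<close>

inductive_set lin_span :: "'k::field free_alg set \<Rightarrow> 'k free_alg set" for G where
  base: "a \<in> G \<Longrightarrow> a \<in> lin_span G"
| add: "a \<in> lin_span G \<Longrightarrow> b \<in> lin_span G \<Longrightarrow> a + b \<in> lin_span G"
| scal: "a \<in> lin_span G \<Longrightarrow> scal c * a \<in> lin_span G"

lemma lin_span_mult:
  assumes "\<And>g. g \<in> G \<Longrightarrow> a * g \<in> lin_span H" and "b \<in> lin_span G"
  shows "a * b \<in> lin_span H"
  using assms(2)
proof induction
  case (scal b c)
  have "a * (scal c * b) = scal c * (a * b)"
    by (simp only: scal_commute[of c] mult.assoc)
  with scal show ?case by (simp add: lin_span.scal)
qed (simp_all add: assms(1) distrib_left lin_span.add)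

lemma lin_span_mono: "G \<subseteq> lin_span H \<Longrightarrow> a \<in> lin_span G \<Longrightarrow> a \<in> lin_span H"
  using lin_span_mult[of G 1 H a] by auto

lemma lin_span_sum:
  assumes "0 \<in> lin_span G" "\<And>i. i \<in> A \<Longrightarrow> f i \<in> lin_span G"
  shows "sum f A \<in> lin_span G"
  using assms(2) by (induction A rule: infinite_finite_induct) (simp_all add: assms(1) lin_span.add)

lemma lin_span_eval_at:
  assumes "0 \<in> lin_span G" and stable: "\<And>b. b \<in> lin_span G \<Longrightarrow> a * b \<in> lin_span G"
    and "b \<in> lin_span G"
  shows "eval_at f a * b \<in> lin_span G"
proof -
  have "a ^ i * b \<in> lin_span G" for i
    by (induction i) (simp_all add: assms(3) stable mult.assoc)
  then show ?thesis
    by (auto simp: eval_at_def sum_distrib_right mult.assoc intro!: lin_span_sum lin_span.scal assms(1))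
qed

context gen_weyl
begin

abbreviation "I \<equiv> rel_ideal p q r"

text \<open>
  The ideal is included so that congruence modulo the relations becomes membership
  in a span.  The monomials in \<open>x\<close> and in \<open>y\<close> are first treated separately: stability under \<open>z\<close> holds
  on each ray by itself and is needed before \<open>x\<close> can be applied to the ray of \<open>y\<close>, or \<open>y\<close> to that of
  \<open>x\<close>.
\<close>

definition ray :: "'k free_alg \<Rightarrow> 'k free_alg set" where
  "ray g = I \<union> {g ^ m * gz ^ n |m n. True}"

lemma ray_ideal: "a \<in> I \<Longrightarrow> a \<in> lin_span (ray g)"
  and ray_monomial: "g ^ m * gz ^ n \<in> lin_span (ray g)"
  by (auto simp: ray_def intro!: lin_span.base)

lemma ray_cong: "b \<in> lin_span (ray g) \<Longrightarrow> a - b \<in> I \<Longrightarrow> a \<in> lin_span (ray g)"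
  using lin_span.add[of b "ray g" "a - b"] ray_ideal by simp

lemma ray_mult_gen: "b \<in> lin_span (ray g) \<Longrightarrow> g * b \<in> lin_span (ray g)"
proof (rule lin_span_mult[where G = "ray g"])
  fix h assume "h \<in> ray g"
  then consider "h \<in> I" | m n where "h = g ^ m * gz ^ n" by (auto simp: ray_def)
  then show "g * h \<in> lin_span (ray g)"
    using ray_ideal[OF rel_ideal_mult_left] ray_monomial[of g "Suc _"]
    by cases (auto simp: mult.assoc)
qed

text \<open>
  The commutation relation moves \<open>z\<close> past one factor \<open>g\<close> at a time.
\<close>

lemma ray_mult_z:
  assumes "gz * g - (scal \<alpha> * (g * gz) + scal \<beta> * g) \<in> I" and "b \<in> lin_span (ray g)"
  shows "gz * b \<in> lin_span (ray g)"
proof (rule lin_span_mult[OF _ assms(2)])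
  have mon: "gz * (g ^ m * gz ^ n) \<in> lin_span (ray g)" for m n
  proof (induction m)
    case 0
    then show ?case using ray_monomial[of g 0 "Suc n"] by simp
  next
    case (Suc m)
    let ?w = "g ^ m * gz ^ n"
    have mem: "scal \<alpha> * (g * (gz * ?w)) + scal \<beta> * (g * ?w) \<in> lin_span (ray g)"
      by (intro lin_span.add lin_span.scal ray_mult_gen Suc ray_monomial)
    have eq: "gz * (g ^ Suc m * gz ^ n) - (scal \<alpha> * (g * (gz * ?w)) + scal \<beta> * (g * ?w))
        = (gz * g - (scal \<alpha> * (g * gz) + scal \<beta> * g)) * ?w"
      by (simp add: left_diff_distrib distrib_right mult.assoc)
    have "gz * (g ^ Suc m * gz ^ n) - (scal \<alpha> * (g * (gz * ?w)) + scal \<beta> * (g * ?w)) \<in> I"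
      unfolding eq by (rule rel_ideal_mult_right[OF assms(1)])
    with mem show ?case by (rule ray_cong)
  qed
  fix h assume "h \<in> ray g"
  then consider "h \<in> I" | m n where "h = g ^ m * gz ^ n" by (auto simp: ray_def)
  then show "gz * h \<in> lin_span (ray g)"
    using ray_ideal[OF rel_ideal_mult_left] mon by cases auto
qed

lemma relator_memI:
  shows "gx * gy - eval_at p (scal q * gz + scal r) \<in> I"
    and "gy * gx - eval_at p gz \<in> I"
    and "gx * gz - (scal q * gz + scal r) * gx \<in> I"
    and "gy * gz - scal (inverse q) * (gz - scal r) * gy \<in> I"
  using relators_subset_rel_ideal[of p q r] by (auto simp: relators_def Let_def)

lemma scal_inverse_cancel: "scal (inverse q) * (scal q * a) = a" "scal q * (scal (inverse q) * a) = a"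
  using q_nonzero by (simp_all add: mult.assoc[symmetric] scal_mult[symmetric])

lemma ray_x_mult_z: "b \<in> lin_span (ray gx) \<Longrightarrow> gz * b \<in> lin_span (ray gx)"
proof (rule ray_mult_z)
  have "gz * gx - (scal (inverse q) * (gx * gz) + scal (- (inverse q * r)) * gx)
      = scal (- inverse q) * (gx * gz - (scal q * gz + scal r) * gx)"
    by (simp add: scal_uminus scal_mult right_diff_distrib distrib_left distrib_right mult.assoc
        scal_inverse_cancel)
  then show "gz * gx - (scal (inverse q) * (gx * gz) + scal (- (inverse q * r)) * gx) \<in> I"
    by (simp only: rel_ideal_mult_left[OF relator_memI(3)])
qed

lemma ray_y_mult_z: "b \<in> lin_span (ray gy) \<Longrightarrow> gz * b \<in> lin_span (ray gy)"
proof (rule ray_mult_z)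
  have "gz * gy - (scal q * (gy * gz) + scal r * gy)
      = scal (- q) * (gy * gz - scal (inverse q) * (gz - scal r) * gy)"
    by (simp add: scal_uminus right_diff_distrib left_diff_distrib mult.assoc scal_inverse_cancel)
  then show "gz * gy - (scal q * (gy * gz) + scal r * gy) \<in> I"
    by (simp only: rel_ideal_mult_left[OF relator_memI(4)])
qed

definition ideal_monomials :: "'k free_alg set" where
  "ideal_monomials = ray gx \<union> ray gy"

lemma ray_subset_ideal_monomials:
  assumes "a \<in> lin_span (ray gx) \<or> a \<in> lin_span (ray gy)"
  shows "a \<in> lin_span ideal_monomials"
  using assms lin_span_mono[of "ray gx" ideal_monomials a] lin_span_mono[of "ray gy" ideal_monomials a]
  by (auto simp: ideal_monomials_def intro: lin_span.base)

text \<open>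
  Multiplication by the opposite generator cancels one factor \<open>h\<close> and leaves a polynomial in \<open>s\<close>,
  which acts on the ray of \<open>h\<close> because \<open>s\<close> does.
\<close>

lemma opposite_gen_mult:
  assumes "g * h - eval_at p s \<in> I"
    and stable: "\<And>b. b \<in> lin_span (ray h) \<Longrightarrow> s * b \<in> lin_span (ray h)"
  shows "g * (h ^ m * gz ^ n) \<in> lin_span (ray g) \<union> lin_span (ray h)"
proof (cases m)
  case 0
  then show ?thesis using ray_monomial[of g 1 n] by simp
next
  case (Suc k)
  let ?w = "h ^ k * gz ^ n"
  have mem: "eval_at p s * ?w \<in> lin_span (ray h)"
    by (rule lin_span_eval_at[OF ray_ideal[OF rel_ideal_0] stable ray_monomial])
  have eq: "g * (h ^ Suc k * gz ^ n) - eval_at p s * ?w = (g * h - eval_at p s) * ?w"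
    by (simp add: left_diff_distrib mult.assoc)
  have "g * (h ^ Suc k * gz ^ n) - eval_at p s * ?w \<in> I"
    unfolding eq by (rule rel_ideal_mult_right[OF assms(1)])
  with mem have "g * (h ^ Suc k * gz ^ n) \<in> lin_span (ray h)" by (rule ray_cong)
  with Suc show ?thesis by simp
qed

lemma ideal_monomials_mult_gen:
  assumes "b \<in> lin_span ideal_monomials"
  shows "gen g * b \<in> lin_span ideal_monomials"
proof (rule lin_span_mult[OF _ assms])
  have xy: "gx * (gy ^ m * gz ^ n) \<in> lin_span (ray gx) \<union> lin_span (ray gy)" for m n
    by (rule opposite_gen_mult[OF relator_memI(1)])
       (simp add: distrib_right mult.assoc lin_span.add lin_span.scal ray_y_mult_z)
  have yx: "gy * (gx ^ m * gz ^ n) \<in> lin_span (ray gy) \<union> lin_span (ray gx)" for m n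
    by (rule opposite_gen_mult[OF relator_memI(2)]) (rule ray_x_mult_z)
  fix h assume "h \<in> ideal_monomials"
  then consider "h \<in> I" | m n where "h = gx ^ m * gz ^ n" | m n where "h = gy ^ m * gz ^ n"
    by (auto simp: ideal_monomials_def ray_def)
  then have "gen g * h \<in> lin_span (ray gx) \<union> lin_span (ray gy)"
  proof cases
    case 1
    then show ?thesis using ray_ideal[OF rel_ideal_mult_left] by blast
  next
    case 2
    then show ?thesis
      using ray_mult_gen[OF ray_monomial[of gx m n]] yx[of m n]
        ray_x_mult_z[OF ray_monomial[of gx m n]] by (cases g) auto
  next
    case 3
    then show ?thesis
      using ray_mult_gen[OF ray_monomial[of gy m n]] xy[of m n]
        ray_y_mult_z[OF ray_monomial[of gy m n]] by (cases g) auto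
  qed
  then show "gen g * h \<in> lin_span ideal_monomials" using ray_subset_ideal_monomials by blast
qed

lemma ideal_monomials_span: "a \<in> lin_span ideal_monomials"
proof (induction a rule: free_alg_induct)
  case (single w c)
  have "Poly_Mapping.single (Word l) c \<in> lin_span ideal_monomials" for l
  proof (induction l)
    case Nil
    have "Poly_Mapping.single (Word []) c = scal c * (gx ^ 0 * gz ^ 0)"
      by (simp add: scal_def zero_word_def)
    then show ?case
      by (simp only: lin_span.scal[OF ray_subset_ideal_monomials[OF disjI1[OF ray_monomial]]])
  next
    case (Cons g l)
    then show ?case using ideal_monomials_mult_gen[OF Cons, of g] by (simp add: gen_mult_single)
  qed
  from this[of "letters w"] show ?case by simp
qed (rule lin_span.add)

lemma is_tau_monomial:
  assumes "is_tau p q r \<zeta> \<tau>"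
  shows "\<tau> (cls p q r (gx ^ m * gz ^ n))
      = (if m = 0 \<and> n \<noteq> 0 then hat_tau q r \<zeta> (monom 1 n) else 0)"
    and "\<tau> (cls p q r (gy ^ m * gz ^ n))
      = (if m = 0 \<and> n \<noteq> 0 then hat_tau q r \<zeta> (monom 1 n) else 0)"
  using assms unfolding is_tau_def mono_x_cls mono_y_cls by blast+

lemma is_tau_unique:
  assumes \<tau>: "is_tau p q r \<zeta> \<tau>" and \<tau>': "is_tau p q r \<zeta> \<tau>'"
  shows "\<tau> = \<tau>'"
proof
  fix A
  have lin: "\<tau> \<in> linear_functionals p q r" "\<tau>' \<in> linear_functionals p q r"
    using \<tau> \<tau>' by (simp_all add: is_tau_def)
  have additive: "\<phi> (cls p q r (a + b)) = \<phi> (cls p q r a) + \<phi> (cls p q r b)"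
    and homogeneous: "\<phi> (cls p q r (scal c * a)) = c * \<phi> (cls p q r a)"
    if "\<phi> \<in> linear_functionals p q r" for \<phi> a b c
    using that by (simp_all add: linear_functionals_iff)
  have zero: "\<phi> (cls p q r 0) = 0" if "\<phi> \<in> linear_functionals p q r" for \<phi>
    using homogeneous[OF that, of 0 0] by simp
  have eq: "\<tau> (cls p q r a) = \<tau>' (cls p q r a)" for a
    using ideal_monomials_span[of a]
  proof induction
    case (base a)
    then consider "a \<in> I" | m n where "a = gx ^ m * gz ^ n" | m n where "a = gy ^ m * gz ^ n"
      unfolding ideal_monomials_def ray_def by blast
    then show ?case
    proof cases
      case 1
      then have "cls p q r a = cls p q r 0" by (simp add: cls_eq_iff)
      then show ?thesis by (simp only: zero[OF lin(1)] zero[OF lin(2)])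
    next
      case 2
      then show ?thesis by (simp only: is_tau_monomial[OF \<tau>] is_tau_monomial[OF \<tau>'])
    next
      case 3
      then show ?thesis by (simp only: is_tau_monomial[OF \<tau>] is_tau_monomial[OF \<tau>'])
    qed
  next
    case (add a b)
    then show ?case by (simp only: additive[OF lin(1)] additive[OF lin(2)])
  next
    case (scal a c)
    then show ?case by (simp only: homogeneous[OF lin(1)] homogeneous[OF lin(2)])
  qed
  show "\<tau> A = \<tau>' A"
  proof (cases "A \<in> range (cls p q r)")
    case True
    then show ?thesis using eq by auto
  next
    case False
    moreover have "\<tau> \<in> extensional (range (cls p q r))" "\<tau>' \<in> extensional (range (cls p q r))"
      using lin by (simp_all add: linear_functionals_iff)
    ultimately show ?thesis by (metis extensional_arb)
  qed
qed

end

section \<open>The trace on the quotient\<close>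

context gen_weyl_trace
begin

text \<open>
  The elements \<open>a\<close> with \<open>free_trace (a * b) = 0\<close> for all \<open>b\<close> form a right ideal by construction and
  a left ideal because \<open>free_trace\<close> is a trace; they include the relators.
\<close>

lemma free_trace_rel_ideal:
  assumes "a \<in> rel_ideal p q r"
  shows "free_trace a = 0"
proof -
  define J where "J = {a. \<forall>b. free_trace (a * b) = 0}"
  have "ideal J free_ring"
  proof (rule ideal_free_ringI)
    show "b * a \<in> J" if "a \<in> J" for a b
      using that free_trace_commute[of b "a * _"] by (simp add: J_def mult.assoc)
  qed (auto simp: J_def distrib_right free_trace_add mult.assoc)
  moreover have "relators p q r \<subseteq> J"
    by (auto simp: J_def free_trace_def deg_part_relator_mult)
  ultimately have "rel_ideal p q r \<subseteq> J"
    unfolding rel_ideal_def by (rule ring.genideal_minimal[OF ring_free_ring])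
  with assms have "free_trace (a * 1) = 0" by (auto simp: J_def simp del: mult_1_right)
  then show ?thesis by simp
qed

definition quot_trace :: "'a free_alg set \<Rightarrow> 'a" where
  "quot_trace = restrict (\<lambda>A. free_trace (SOME a. A = cls p q r a)) (range (cls p q r))"

lemma quot_trace_cls: "quot_trace (cls p q r a) = free_trace a"
proof -
  define b where "b = (SOME b. cls p q r a = cls p q r b)"
  have "cls p q r a = cls p q r b" unfolding b_def by (rule someI_ex) blast
  then have "free_trace (a - b) = 0" by (simp add: cls_eq_iff free_trace_rel_ideal)
  then have "free_trace a = free_trace b" using free_trace_add[of "a - b" b] by simp
  then show ?thesis by (simp add: quot_trace_def b_def)
qed

lemma deg_part_z_power: "deg_part d (gz ^ n) = (if d = 0 then monom 1 n else 0)"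
  by (induction n) (simp_all add: deg_part_one deg_part_z_mult monom_Suc)

lemma deg_part_x_power_mult: "deg_part d (gx ^ m * gz ^ n) = 0" if "d \<noteq> int m"
  using that by (induction m arbitrary: d) (simp_all add: deg_part_z_power mult.assoc deg_part_x_mult)

lemma deg_part_y_power_mult: "deg_part d (gy ^ m * gz ^ n) = 0" if "d \<noteq> - int m"
  using that by (induction m arbitrary: d) (simp_all add: deg_part_z_power mult.assoc deg_part_y_mult)

lemma quot_trace_linear: "quot_trace \<in> linear_functionals p q r"
  by (auto simp: linear_functionals_iff quot_trace_cls free_trace_add free_trace_scal_mult)
     (simp add: quot_trace_def)

lemma quot_trace_is_tau: "is_tau p q r \<zeta> quot_trace"
proof -
  have "free_trace (gx ^ m * gz ^ n) = free_trace (gy ^ m * gz ^ n)"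
    "free_trace (gx ^ m * gz ^ n)
      = (if m = 0 \<and> n \<noteq> 0 then hat_tau q r \<zeta> (monom 1 n) else 0)" for m n
    using deg_part_x_power_mult[of 0 m n] deg_part_y_power_mult[of 0 m n]
      hat_tau_monom_1[of q r \<zeta> n]
    by (cases "m = 0"; simp add: free_trace_def deg_part_z_power hat_tau_monom_def)+
  then show ?thesis
    using quot_trace_linear by (simp add: is_tau_def mono_x_cls mono_y_cls quot_trace_cls)
qed

lemma quot_trace_is_trace: "is_trace p q r quot_trace"
  using quot_trace_linear by (simp add: is_trace_iff quot_trace_cls free_trace_commute)

end

theorem lemma3p4:
  fixes p :: "'k::field_char_0 poly" and q r \<zeta> :: 'k
  assumes "p \<noteq> 0" and "poly p 0 = 0"
    and "q \<noteq> 0" and "\<forall>n\<ge>1. q ^ n \<noteq> 1"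
    and "poly p \<zeta> = 0"
  shows "(\<exists>!\<tau>. is_tau p q r \<zeta> \<tau>) \<and> (\<forall>\<tau>. is_tau p q r \<zeta> \<tau> \<longrightarrow> is_trace p q r \<tau>)"
proof -
  interpret gen_weyl_trace p q r \<zeta>
    using assms by unfold_locales
  have unique: "\<tau> = quot_trace" if "is_tau p q r \<zeta> \<tau>" for \<tau>
    using that quot_trace_is_tau by (rule is_tau_unique)
  show ?thesis
  proof (intro conjI allI impI)
    show "\<exists>!\<tau>. is_tau p q r \<zeta> \<tau>"
      using quot_trace_is_tau unique by (rule ex1I)
    show "is_trace p q r \<tau>" if "is_tau p q r \<zeta> \<tau>" for \<tau>
      unfolding unique[OF that] by (rule quot_trace_is_trace)
  qed
qed

end
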